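(* For every real $k\neq 0$ and every $t\in\mathbb{R}$, there exist an integer $n>0$ and a point $(x_0,y_0)\in\mathbb{T}^2$ such that $a_n<0$, where, writing $(x_j,y_j):=f_{k,t}^{\,j}(x_0,y_0)$ for $j\ge 0$, the sequence $(a_j)_{j\ge0}$ is defined by $a_0=0$, $a_1=1$ and $$a_{j+1}=\bigl[2+2\pi k\cos(2\pi x_j)\bigr]a_j-a_{j-1}\qquad (j\ge 1).$$
   Context: $\mathbb{T}^2=\mathbb{R}^2/\mathbb{Z}^2$. For $k,t\in\mathbb{R}$, $f_{k,t}:\mathbb{T}^2\to\mathbb{T}^2$ is the map $$f_{k,t}(x,y)=\bigl(x+y+k\sin(2\pi x)\bmod 1,\ y+k\sin(2\pi x)+t\bmod 1\bigr).$$ *)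

theory Defs
  imports Complex_Main
begin

definition torus_rel :: "real \<times> real \<Rightarrow> real \<times> real \<Rightarrow> bool" where
  "torus_rel p q \<longleftrightarrow> fst p - fst q \<in> \<int> \<and> snd p - snd q \<in> \<int>"

lemma equivp_torus_rel: "equivp torus_rel"
proof (rule equivpI)
  show "reflp torus_rel"
    by (simp add: reflp_def torus_rel_def)
  show "symp torus_rel"
    unfolding symp_def torus_rel_def by (metis Ints_minus minus_diff_eq)
  show "transp torus_rel"
  proof (rule transpI)
    fix p q r
    assume pq: "torus_rel p q" and qr: "torus_rel q r"
    have "fst p - fst r = (fst p - fst q) + (fst q - fst r)"
      and "snd p - snd r = (snd p - snd q) + (snd q - snd r)"
      by simp_all
    with pq qr show "torus_rel p r"
      unfolding torus_rel_def by (metis Ints_add)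
  qed
qed

quotient_type torus = "real \<times> real" / torus_rel
  by (rule equivp_torus_rel)

lemma sin_cos_2pi_cong:
  fixes x y :: real
  assumes "x - y \<in> \<int>"
  shows "sin (2 * pi * x) = sin (2 * pi * y)" and "cos (2 * pi * x) = cos (2 * pi * y)"
proof -
  obtain m :: int where "x - y = of_int m"
    using assms by (auto elim: Ints_cases)
  then have "2 * pi * x = 2 * pi * y + 2 * pi * of_int m"
    by (simp add: algebra_simps flip: distrib_left)
  then show "sin (2 * pi * x) = sin (2 * pi * y)" and "cos (2 * pi * x) = cos (2 * pi * y)"
    by (simp_all add: sin_add cos_add)
qed

text \<open>No reduction mod 1 appears in the formula, since its value is read as a class in the
  quotient.\<close>

lift_definition std_map :: "real \<Rightarrow> real \<Rightarrow> torus \<Rightarrow> torus" is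
  "\<lambda>k t (x, y). (x + y + k * sin (2 * pi * x), y + k * sin (2 * pi * x) + t)"
proof -
  fix k t :: real and p q :: "real \<times> real"
  assume "torus_rel p q"
  moreover obtain x y x' y' where pq: "p = (x, y)" "q = (x', y')"
    by (cases p, cases q)
  ultimately have x: "x - x' \<in> \<int>" and y: "y - y' \<in> \<int>"
    by (simp_all add: torus_rel_def)
  have "(x + y) - (x' + y') \<in> \<int>"
    using Ints_add[OF x y] by (simp add: algebra_simps)
  then show "torus_rel
      (case p of (x, y) \<Rightarrow> (x + y + k * sin (2 * pi * x), y + k * sin (2 * pi * x) + t))
      (case q of (x, y) \<Rightarrow> (x + y + k * sin (2 * pi * x), y + k * sin (2 * pi * x) + t))"
    using y by (simp add: pq torus_rel_def sin_cos_2pi_cong(1)[OF x])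
qed

text \<open>The function \<open>(x, y) \<mapsto> cos (2 \<pi> x)\<close>, which is well defined on the torus although the
  coordinate \<open>x\<close> itself is not.\<close>

lift_definition cos_2pi_fst :: "torus \<Rightarrow> real" is "\<lambda>(x, y). cos (2 * pi * x)"
  by (auto simp: torus_rel_def intro: sin_cos_2pi_cong(2))

fun jacobi_seq :: "real \<Rightarrow> real \<Rightarrow> torus \<Rightarrow> nat \<Rightarrow> real" where
  "jacobi_seq k t p 0 = 0"
| "jacobi_seq k t p (Suc 0) = 1"
| "jacobi_seq k t p (Suc (Suc j)) =
     (2 + 2 * pi * k * cos_2pi_fst ((std_map k t ^^ Suc j) p)) * jacobi_seq k t p (Suc j)
       - jacobi_seq k t p j"

end

theory Submission
  imports Defs "HOL-Analysis.Analysis"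
begin

text \<open>
  The argument is a discrete version of E. Hopf's theorem that a Riemannian two-torus without
  conjugate points is flat.

  Suppose that \<open>a\<^sub>n \<ge> 0\<close> for all \<open>n\<close> along every orbit. A first zero \<open>a\<^sub>n = 0\<close> with \<open>n > 0\<close> would force
  \<open>a\<^sub>n\<^sub>+\<^sub>1 = - a\<^sub>n\<^sub>-\<^sub>1 < 0\<close>, so all \<open>a\<^sub>n\<close> with \<open>n > 0\<close> are positive and the ratios
  \<open>r\<^sub>i = a\<^sub>i\<^sub>+\<^sub>2 / a\<^sub>i\<^sub>+\<^sub>1\<close> are positive solutions of the Riccati equation
  \<open>r\<^sub>i\<^sub>+\<^sub>1 + 1 / r\<^sub>i = c\<^sub>i\<close>, where \<open>c\<^sub>i = 2 + 2 \<pi> k cos (2 \<pi> x\<^sub>i\<^sub>+\<^sub>2)\<close>. The inequality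
  \<open>ln s \<le> s - 1\<close> gives \<open>c\<^sub>i - 2 \<ge> ln r\<^sub>i\<^sub>+\<^sub>1 - ln r\<^sub>i\<close>, and its quantitative form improves this
  by a positive multiple of \<open>(c\<^sub>i - 2)\<^sup>2\<close>. Since \<open>r\<^sub>i\<close> and \<open>1 / r\<^sub>i\<close> are bounded by
  \<open>M = 2 + 2 \<pi> \<bar>k\<bar>\<close>, the logarithms telescope to something bounded, and
  \<open>\<Sum>i<N. ((c\<^sub>i - 2)\<^sup>2 / (4 M + 4) - (c\<^sub>i - 2))\<close> is at most \<open>2 ln M\<close> for every orbit and
  every \<open>N\<close> (lemma \<open>riccati_sum_bound\<close>).

  The map preserves area (lemma \<open>torus_integral_std_map\<close>), so integrating this bound over the
  torus replaces every summand by the same number. Now \<open>c\<^sub>i - 2\<close> has mean \<open>0\<close> and its square has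
  mean \<open>2 \<pi>\<^sup>2 k\<^sup>2\<close>, so the integral of the sum is \<open>N\<close> times a positive constant when \<open>k \<noteq> 0\<close>,
  which is impossible for large \<open>N\<close>. Working with finite sums and a fixed bound, rather than with
  the limit of the \<open>r\<^sub>i\<close> pulled back along the orbit, keeps all integrands continuous.
\<close>

section \<open>Positive solutions of a Riccati recursion\<close>

text \<open>
  The gap in \<open>ln s \<le> s - 1\<close> is quadratic on bounded sets: with \<open>q = \<surd>s\<close> one has
  \<open>ln s = 2 ln q \<le> 2 (q - 1)\<close>, so \<open>s - 1 - ln s \<ge> (q - 1)\<^sup>2\<close>, while
  \<open>(s - 1)\<^sup>2 = (q - 1)\<^sup>2 (q + 1)\<^sup>2\<close> and \<open>(q + 1)\<^sup>2 \<le> 2 s + 2\<close>.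
\<close>

lemma square_le_ln_gap:
  fixes s M :: real
  assumes "0 < s" "s \<le> M"
  shows "(s - 1)\<^sup>2 \<le> (2 * M + 2) * (s - 1 - ln s)"
proof -
  define q where "q = sqrt s"
  have q: "q > 0" "s = q\<^sup>2"
    using assms(1) by (simp_all add: q_def)
  have "ln s = 2 * ln q"
    using q by (simp add: ln_realpow)
  with ln_le_minus_one[OF q(1)] have gap: "(q - 1)\<^sup>2 \<le> s - 1 - ln s"
    by (simp add: q(2) power2_diff)
  have "0 \<le> (q - 1)\<^sup>2" by simp
  then have "(q + 1)\<^sup>2 \<le> 2 * s + 2"
    by (simp add: q(2) power2_eq_square algebra_simps)
  with assms(2) have "(q + 1)\<^sup>2 \<le> 2 * M + 2" by simp
  then have "(q + 1)\<^sup>2 * (q - 1)\<^sup>2 \<le> (2 * M + 2) * (s - 1 - ln s)"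
    using gap assms by (intro mult_mono) auto
  moreover have "(s - 1)\<^sup>2 = (q + 1)\<^sup>2 * (q - 1)\<^sup>2"
    by (simp add: q(2) power2_eq_square algebra_simps)
  ultimately show ?thesis by simp
qed

text \<open>
  Applying the gap inequality to \<open>r (Suc i)\<close> and to \<open>1 / r i\<close> and adding the two results turns
  \<open>d i - 2\<close> into a telescoping difference of logarithms plus a nonnegative term that dominates
  \<open>(d i - 2)\<^sup>2\<close>. Together with \<open>r 0 \<le> M\<close>, the upper bound on \<open>d\<close> controls both \<open>r\<close> and \<open>1 / r\<close>, since the two summands in
  the recursion are positive; hence what remains after telescoping is bounded independently of \<open>n\<close>.
\<close>

lemma riccati_sum_bound:
  fixes r d :: "nat \<Rightarrow> real" and M :: real
  assumes pos: "\<And>i. r i > 0"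
    and start: "r 0 \<le> M"
    and rec: "\<And>i. r (Suc i) + 1 / r i = d i"
    and bound: "\<And>i. d i \<le> M"
  shows "(\<Sum>i<n. (d i - 2)\<^sup>2 / (4 * M + 4) - (d i - 2)) \<le> 2 * ln M"
proof -
  have inv_pos: "1 / r i > 0" for i
    using pos by simp
  have inv_le: "1 / r i \<le> M" for i
    using rec[of i] bound[of i] pos[of "Suc i"] by linarith
  have le: "r i \<le> M" for i
  proof (cases i)
    case (Suc j)
    then show ?thesis using rec[of j] bound[of j] inv_pos[of j] by (simp only:)
  qed (simp add: start)
  have M: "M > 0"
    using pos[of 0] start by linarith
  have "(d i - 2)\<^sup>2 / (4 * M + 4) - (d i - 2) \<le> ln (r i) - ln (r (Suc i))" for i
  proof -
    define u v where "u = r (Suc i)" and "v = 1 / r i"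
    have d: "d i - 2 = (u - 1) + (v - 1)"
      using rec[of i] by (simp add: u_def v_def)
    have "0 \<le> ((u - 1) - (v - 1))\<^sup>2" by simp
    then have "(d i - 2)\<^sup>2 \<le> 2 * (u - 1)\<^sup>2 + 2 * (v - 1)\<^sup>2"
      unfolding d power2_eq_square by (simp add: algebra_simps)
    also have "\<dots> \<le> 2 * ((2 * M + 2) * (u - 1 - ln u)) + 2 * ((2 * M + 2) * (v - 1 - ln v))"
      using square_le_ln_gap[of u M] square_le_ln_gap[of v M] pos[of "Suc i"] le[of "Suc i"]
        inv_pos[of i] inv_le[of i]
      unfolding u_def v_def by linarith
    also have "\<dots> = (4 * M + 4) * ((d i - 2) + ln (r i) - ln (r (Suc i)))"
      using pos[of i] by (simp add: d v_def u_def ln_div algebra_simps)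
    finally have "(d i - 2)\<^sup>2 / (4 * M + 4) \<le> (d i - 2) + ln (r i) - ln (r (Suc i))"
      using M by (simp add: divide_le_eq mult.commute)
    then show ?thesis by simp
  qed
  then have "(\<Sum>i<n. (d i - 2)\<^sup>2 / (4 * M + 4) - (d i - 2)) \<le> (\<Sum>i<n. ln (r i) - ln (r (Suc i)))"
    by (intro sum_mono)
  also have "\<dots> = ln (r 0) + ln (1 / r n)"
    using pos[of n] sum_lessThan_telescope'[of "\<lambda>i. ln (r i)" n] by (simp add: ln_div)
  also have "\<dots> \<le> ln M + ln M"
    using pos[of 0] start inv_pos[of n] inv_le[of n] M by (intro add_mono) (simp_all only: ln_le_cancel_iff)
  finally show ?thesis by simp
qed

section \<open>Integration over the torus\<close>

lemma integral_periodic_shift: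
  fixes g :: "real \<Rightarrow> real"
  assumes cont: "continuous_on UNIV g"
    and per: "\<And>x (m::int). g (x + of_int m) = g x"
  shows "integral {0..1} (\<lambda>x. g (x + c)) = integral {0..1} g"
proof -
  have int: "g integrable_on {a..b}" for a b
    using cont by (intro integrable_continuous_real continuous_on_subset[OF cont]) auto
  have shift: "integral {a..b} (\<lambda>x. g (x + e)) = integral {a+e..b+e} g" for a b e
    using integral_shift_real_ivl[of "a+e" e "b+e" g] by simp
  \<comment> \<open>Only the fractional part of the shift matters; the piece of \<open>{e..1+e}\<close> that sticks out of the
    unit interval is moved back by one period.\<close>
  define e where "e = frac c"
  have e: "0 \<le> e" "e \<le> 1"
    using frac_lt_1[of c] by (simp_all add: e_def)
  have "c = e + of_int \<lfloor>c\<rfloor>" by (simp add: e_def frac_def)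
  then have "g (x + c) = g (x + e)" for x
    using per[of "x + e" "\<lfloor>c\<rfloor>"] by (simp add: add.assoc)
  then have "integral {0..1} (\<lambda>x. g (x + c)) = integral {e..1+e} g"
    using shift[of 0 1 e] by simp
  also have "\<dots> = integral {e..1} g + integral {1..1+e} g"
    using e int by (subst Henstock_Kurzweil_Integration.integral_combine) auto
  also have "integral {1..1+e} g = integral {0..e} (\<lambda>x. g (x + of_int 1))"
    using shift[of 0 e 1] by (simp add: add.commute)
  also have "\<dots> = integral {0..e} g"
    by (simp only: per)
  also have "integral {e..1} g + integral {0..e} g = integral {0..1} g"
    using e int by (subst add.commute, subst Henstock_Kurzweil_Integration.integral_combine) auto
  finally show ?thesis .
qed

text \<open>
  Continuity of a function on the torus is expressed throughout as continuity of its lift to the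
  plane, so that no topology on the quotient type is needed.
\<close>

definition torus_continuous :: "(torus \<Rightarrow> real) \<Rightarrow> bool" where
  "torus_continuous g \<longleftrightarrow> continuous_on UNIV (\<lambda>z. g (abs_torus z))"

definition torus_integral :: "(torus \<Rightarrow> real) \<Rightarrow> real" where
  "torus_integral g = integral (cbox (0, 0) (1, 1)) (\<lambda>z. g (abs_torus z))"

lemma abs_torus_add_int:
  "abs_torus (x + of_int m, y + of_int n) = abs_torus (x, y)"
  by (simp add: torus.abs_eq_iff torus_rel_def)

lemma torus_continuous_integrable:
  assumes "torus_continuous g"
  shows "(\<lambda>z. g (abs_torus z)) integrable_on cbox (0, 0) (1, 1)"
  using assms unfolding torus_continuous_def
  by (intro integrable_continuous) (auto intro: continuous_on_subset)

lemma torus_integral_iterated: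
  assumes "torus_continuous g"
  shows "torus_integral g = integral {0..1} (\<lambda>x. integral {0..1} (\<lambda>y. g (abs_torus (x, y))))"
  using integral_prod_continuous[of 0 0 1 1 "\<lambda>z. g (abs_torus z)"] assms
  by (simp add: torus_integral_def torus_continuous_def continuous_on_subset[of UNIV])

lemma std_map_abs_torus:
  "std_map k t (abs_torus (x, y))
     = abs_torus (x + y + k * sin (2 * pi * x), y + k * sin (2 * pi * x) + t)"
  by (simp add: std_map.abs_eq)

lemma cos_2pi_fst_abs_torus: "cos_2pi_fst (abs_torus (x, y)) = cos (2 * pi * x)"
  by (simp add: cos_2pi_fst.abs_eq)

lemma torus_continuous_std_map:
  assumes "torus_continuous g"
  shows "torus_continuous (\<lambda>p. g (std_map k t p))"
proof -
  let ?F = "\<lambda>z :: real \<times> real. (fst z + snd z + k * sin (2 * pi * fst z),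
                     snd z + k * sin (2 * pi * fst z) + t)"
  have "(\<lambda>z. g (std_map k t (abs_torus z))) = (\<lambda>z. g (abs_torus (?F z)))"
  proof
    fix z :: "real \<times> real"
    show "g (std_map k t (abs_torus z)) = g (abs_torus (?F z))"
      by (cases z) (simp add: std_map_abs_torus)
  qed
  moreover have "continuous_on UNIV (\<lambda>z. g (abs_torus (?F z)))"
    using assms unfolding torus_continuous_def
    by (rule continuous_on_compose2) (auto intro!: continuous_intros)
  ultimately show ?thesis by (simp only: torus_continuous_def)
qed

text \<open>
  The map is a composition of shears and translations, each of which moves one coordinate by an
  amount that depends only on the other. On the circle of the moving coordinate such a map is a
  rotation, so it does not change the inner one of the two iterated integrals.
\<close>

lemma torus_integral_std_map:
  assumes "torus_continuous g"
  shows "torus_integral (\<lambda>p. g (std_map k t p)) = torus_integral g"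
proof -
  let ?G = "\<lambda>x y. g (abs_torus (x, y))"
  have cont: "continuous_on A (\<lambda>z. ?G (u z) (v z))"
    if "continuous_on A u" "continuous_on A v" for A :: "'a::topological_space set" and u v
    using assms that unfolding torus_continuous_def
    by (intro continuous_on_compose2[of UNIV "\<lambda>z. g (abs_torus z)" A "\<lambda>z. (u z, v z)"])
      (auto intro!: continuous_intros)
  have per: "?G (x + of_int m) (y + of_int n) = ?G x y" for x y m n
    by (simp only: abs_torus_add_int)
  have "torus_integral (\<lambda>p. g (std_map k t p)) =
      integral {0..1} (\<lambda>x. integral {0..1} (\<lambda>y.
        ?G (x + (y + k * sin (2 * pi * x))) ((y + k * sin (2 * pi * x)) + t)))"
    using torus_continuous_std_map[OF assms, of k t]
    by (simp add: torus_integral_iterated std_map_abs_torus add.assoc)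
  also have "\<dots> = integral {0..1} (\<lambda>x. integral {0..1} (\<lambda>y. ?G (x + y) (y + t)))"
  proof (rule Henstock_Kurzweil_Integration.integral_cong)
    fix x :: real
    show "integral {0..1} (\<lambda>y. ?G (x + (y + k * sin (2 * pi * x))) ((y + k * sin (2 * pi * x)) + t))
        = integral {0..1} (\<lambda>y. ?G (x + y) (y + t))"
    proof (rule integral_periodic_shift[where g = "\<lambda>y. ?G (x + y) (y + t)"])
      show "continuous_on UNIV (\<lambda>y. ?G (x + y) (y + t))"
        by (intro cont continuous_intros)
      show "?G (x + (y + of_int m)) (y + of_int m + t) = ?G (x + y) (y + t)" for y m
        using per[of "x + y" m "y + t" m] by (simp add: add_ac)
    qed
  qed
  also have "\<dots> = integral {0..1} (\<lambda>y. integral {0..1} (\<lambda>x. ?G (x + y) (y + t)))"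
    using integral_swap_continuous[of 0 0 1 1 "\<lambda>x y. ?G (x + y) (y + t)"]
    by (simp add: case_prod_unfold cont continuous_intros)
  also have "\<dots> = integral {0..1} (\<lambda>y. integral {0..1} (\<lambda>x. ?G x (y + t)))"
  proof (rule Henstock_Kurzweil_Integration.integral_cong)
    fix y :: real
    show "integral {0..1} (\<lambda>x. ?G (x + y) (y + t)) = integral {0..1} (\<lambda>x. ?G x (y + t))"
    proof (rule integral_periodic_shift[where g = "\<lambda>x. ?G x (y + t)"])
      show "continuous_on UNIV (\<lambda>x. ?G x (y + t))"
        by (intro cont continuous_intros)
      show "?G (x + of_int m) (y + t) = ?G x (y + t)" for x m
        using per[of x m "y + t" 0] by simp
    qed
  qed
  also have "\<dots> = integral {0..1} (\<lambda>x. integral {0..1} (\<lambda>y. ?G x (y + t)))"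
    using integral_swap_continuous[of 0 0 1 1 "\<lambda>x y. ?G x (y + t)"]
    by (simp add: case_prod_unfold cont continuous_intros)
  also have "\<dots> = integral {0..1} (\<lambda>x. integral {0..1} (\<lambda>y. ?G x y))"
  proof (rule Henstock_Kurzweil_Integration.integral_cong)
    fix x :: real
    show "integral {0..1} (\<lambda>y. ?G x (y + t)) = integral {0..1} (\<lambda>y. ?G x y)"
    proof (rule integral_periodic_shift[where g = "\<lambda>y. ?G x y"])
      show "continuous_on UNIV (\<lambda>y. ?G x y)"
        by (intro cont continuous_intros)
      show "?G x (y + of_int m) = ?G x y" for y m
        using per[of x 0 y m] by simp
    qed
  qed
  also have "\<dots> = torus_integral g"
    by (simp add: torus_integral_iterated assms)
  finally show ?thesis .
qed

lemma
  assumes "torus_continuous g"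
  shows torus_continuous_funpow: "torus_continuous (\<lambda>p. g ((std_map k t ^^ n) p))"
    and torus_integral_funpow: "torus_integral (\<lambda>p. g ((std_map k t ^^ n) p)) = torus_integral g"
proof (induction n)
  case 0
  case 1
  show ?case using assms by simp
  case 2
  show ?case by simp
next
  case (Suc n)
  case 1
  show ?case
    using torus_continuous_std_map[OF Suc(1)] by (simp add: funpow_Suc_right del: funpow.simps)
  case 2
  show ?case
    using torus_integral_std_map[OF Suc(1)] Suc(2)
    by (simp add: funpow_Suc_right del: funpow.simps)
qed

lemma integral_cos_quadratic:
  fixes \<alpha> \<beta> :: real
  shows "integral {0..1} (\<lambda>x. \<alpha> * (cos (2 * pi * x))\<^sup>2 - \<beta> * cos (2 * pi * x)) = \<alpha> / 2"
proof -
  let ?P = "\<lambda>x. \<alpha> * (x / 2 + sin (2 * pi * x) * cos (2 * pi * x) / (4 * pi))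
                - \<beta> * sin (2 * pi * x) / (2 * pi)"
  have deriv: "(?P has_real_derivative \<alpha> * (cos (2 * pi * x))\<^sup>2 - \<beta> * cos (2 * pi * x))
      (at x within {0..1})" for x
  proof -
    have "(?P has_real_derivative
        \<alpha> * (1 / 2 + ((cos (2 * pi * x))\<^sup>2 - (sin (2 * pi * x))\<^sup>2) / 2) - \<beta> * cos (2 * pi * x))
      (at x within {0..1})"
      by (auto intro!: derivative_eq_intros simp: field_simps power2_eq_square)
    moreover have "1 / 2 + ((cos (2 * pi * x))\<^sup>2 - (sin (2 * pi * x))\<^sup>2) / 2 = (cos (2 * pi * x))\<^sup>2"
      by (simp add: sin_squared_eq field_simps)
    ultimately show ?thesis by (simp only:)
  qed
  have "((\<lambda>x. \<alpha> * (cos (2 * pi * x))\<^sup>2 - \<beta> * cos (2 * pi * x)) has_integral ?P 1 - ?P 0) {0..1}"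
    using deriv by (intro fundamental_theorem_of_calculus)
      (auto simp: has_real_derivative_iff_has_vector_derivative)
  then show ?thesis by (simp add: integral_unique)
qed

section \<open>The sequence of Jacobi fields\<close>

lemma jacobi_seq_pos:
  assumes "\<And>n. jacobi_seq k t p n \<ge> 0"
  shows "jacobi_seq k t p (Suc n) > 0"
proof (induction n)
  case (Suc n)
  show ?case
  proof (rule ccontr)
    assume "\<not> ?thesis"
    with assms[of "Suc (Suc n)"] have "jacobi_seq k t p (Suc (Suc n)) = 0"
      by linarith
    then have "jacobi_seq k t p (Suc (Suc (Suc n))) = - jacobi_seq k t p (Suc n)"
      by (subst jacobi_seq.simps(3)) simp
    with Suc.IH assms[of "Suc (Suc (Suc n))"] show False by linarith
  qed
qed simp

text \<open>
  The orbit is sampled from index \<open>2\<close> on because the Riccati recursion for the ratios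
  \<open>a\<^sub>i\<^sub>+\<^sub>2 / a\<^sub>i\<^sub>+\<^sub>1\<close> starts there: \<open>a\<^sub>0 = 0\<close> makes the ratio \<open>a\<^sub>1 / a\<^sub>0\<close> meaningless, and
  \<open>a\<^sub>2 / a\<^sub>1\<close> is the coefficient at index \<open>1\<close> alone.
\<close>

lemma jacobi_seq_nonneg_sum_bound:
  fixes k t :: real
  defines "b \<equiv> 2 * pi * k"
  defines "M \<equiv> 2 + \<bar>b\<bar>"
  assumes nonneg: "\<And>n. jacobi_seq k t p n \<ge> 0"
  shows "(\<Sum>i<n. (b * cos_2pi_fst ((std_map k t ^^ (i + 2)) p))\<^sup>2 / (4 * M + 4)
            - b * cos_2pi_fst ((std_map k t ^^ (i + 2)) p)) \<le> 2 * ln M"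
proof -
  define a where "a = jacobi_seq k t p"
  define c where "c i = 2 + b * cos_2pi_fst ((std_map k t ^^ i) p)" for i
  define r where "r i = a (i + 2) / a (i + 1)" for i
  have pos: "a (i + 1) > 0" for i
    using jacobi_seq_pos[OF nonneg, of i] by (simp add: a_def)
  have rec: "a (i + 2) = c (i + 1) * a (i + 1) - a i" for i
    by (simp add: a_def c_def b_def)
  have c_le: "c i \<le> M" for i
  proof -
    have "\<bar>cos_2pi_fst q\<bar> \<le> 1" for q
      by transfer (auto split: prod.split)
    then have "\<bar>b\<bar> * \<bar>cos_2pi_fst ((std_map k t ^^ i) p)\<bar> \<le> \<bar>b\<bar>"
      by (rule mult_left_le) simp
    then have "\<bar>b * cos_2pi_fst ((std_map k t ^^ i) p)\<bar> \<le> \<bar>b\<bar>"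
      by (simp add: abs_mult)
    then show ?thesis by (simp add: c_def M_def)
  qed
  have "(\<Sum>i<n. (c (i + 2) - 2)\<^sup>2 / (4 * M + 4) - (c (i + 2) - 2)) \<le> 2 * ln M"
  proof (rule riccati_sum_bound[where r = r and d = "\<lambda>i. c (i + 2)"])
    show "r i > 0" for i
      using pos[of i] pos[of "i + 1"] by (simp add: r_def)
    have "r 0 = c 1"
      using rec[of 0] by (simp add: r_def a_def)
    then show "r 0 \<le> M" using c_le by simp
    show "r (Suc i) + 1 / r i = c (i + 2)" for i
    proof -
      have "r (Suc i) + 1 / r i = (a (i + 3) + a (i + 1)) / a (i + 2)"
        by (simp add: r_def add_divide_distrib eval_nat_numeral)
      also have "a (i + 3) + a (i + 1) = c (i + 2) * a (i + 2)"
        using rec[of "i + 1"] by (simp add: eval_nat_numeral)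
      finally show ?thesis using pos[of "i + 1"] by simp
    qed
    show "c (i + 2) \<le> M" for i by (rule c_le)
  qed
  then show ?thesis by (simp add: c_def)
qed

theorem lemma3:
  fixes k t :: real
  assumes "k \<noteq> 0"
  shows "\<exists>n > 0. \<exists>p :: torus. jacobi_seq k t p n < 0"
proof (rule ccontr)
  assume contra: "\<not> ?thesis"
  have nonneg: "jacobi_seq k t p n \<ge> 0" for p n
  proof (cases "n = 0")
    case False
    then show ?thesis using contra by (meson gr0I not_le)
  qed simp
  define b where "b = 2 * pi * k"
  define M where "M = 2 + \<bar>b\<bar>"
  \<comment> \<open>The summand of the bound along an orbit, as a function on the torus, and its mean.\<close>
  define h where "h q = b\<^sup>2 / (4 * M + 4) * (cos_2pi_fst q)\<^sup>2 - b * cos_2pi_fst q" for q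
  define \<delta> where "\<delta> = b\<^sup>2 / (4 * M + 4) / 2"
  let ?f = "\<lambda>i p. (std_map k t ^^ (i + 2)) p"
  have "\<delta> > 0"
    using assms by (simp add: \<delta>_def b_def M_def add_pos_nonneg)
  have h_lift: "h (abs_torus z) =
      b\<^sup>2 / (4 * M + 4) * (cos (2 * pi * fst z))\<^sup>2 - b * cos (2 * pi * fst z)" for z
    by (cases z) (simp add: h_def cos_2pi_fst_abs_torus)
  have h_cont: "torus_continuous h"
    unfolding torus_continuous_def h_lift by (intro continuous_intros)
  have h_int: "torus_integral h = \<delta>"
    by (simp add: torus_integral_iterated[OF h_cont] h_lift integral_cos_quadratic \<delta>_def
        del: times_divide_eq_left times_divide_eq_right)
  have "of_nat n * \<delta> \<le> 2 * ln M" for n :: nat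
  proof -
    have int: "(\<lambda>z. h (?f i (abs_torus z))) integrable_on cbox (0, 0) (1, 1)" for i
      by (rule torus_continuous_integrable torus_continuous_funpow h_cont)+
    have "(\<Sum>i<n. h (?f i p)) \<le> 2 * ln M" for p
      using jacobi_seq_nonneg_sum_bound[of k t p n] nonneg
      by (simp add: h_def M_def b_def power_mult_distrib)
    then have "integral (cbox (0, 0) (1, 1)) (\<lambda>z. \<Sum>i<n. h (?f i (abs_torus z)))
        \<le> integral (cbox (0, 0) (1, 1 :: real)) (\<lambda>z :: real \<times> real. 2 * ln M)"
      using int by (intro integral_le integrable_sum integrable_const) auto
    also have "\<dots> = 2 * ln M"
      by (simp add: content_Pair)
    also have "integral (cbox (0, 0) (1, 1)) (\<lambda>z. \<Sum>i<n. h (?f i (abs_torus z)))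
        = (\<Sum>i<n. torus_integral (\<lambda>p. h (?f i p)))"
      using int unfolding torus_integral_def
      by (intro Henstock_Kurzweil_Integration.integral_sum) auto
    also have "\<dots> = of_nat n * \<delta>"
      by (simp only: torus_integral_funpow[OF h_cont] h_int) simp
    finally show ?thesis .
  qed
  moreover obtain n :: nat where "2 * ln M < of_nat n * \<delta>"
    using \<open>\<delta> > 0\<close> reals_Archimedean3 by blast
  ultimately show False by (meson not_le)
qed

end
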